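(* Let $\mathbb{N}=A_1\cup\dots\cup A_r$ be a partition of $\mathbb{N}$ into finitely many classes. Then there is an index $i$ and elements $y\in A_i$, $x_{n,j}\in A_i$ (for all $n\in\mathbb{N}$, $1\le j\le n$) and $z_n\in A_i$ (for all $n\in\mathbb{N}$) such that for every $n\in\mathbb{N}$, $$x_{n,1}+x_{n,2}+\dots+x_{n,n}+2^n y=z_n.$$
   Context: $\mathbb{N}=\{1,2,3,\dots\}$. The values of distinct variables need not be distinct. *)

theory Defs
  imports Main "HOL-Library.Disjoint_Sets"
begin

end

(* If all x n j with j > 1 are equal to y, the n-th equation says z n - x n 1 = (2^n + n - 1) * y, so
   any finite part of the system is solved by Brauer's theorem.  For a set A that does not have
   density zero, n A - A is, for all large n, a full residue class modulo a fixed m; it contains the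
   numbers -2^n * y with m | y unless A misses the multiples of m.  Among the sets of multiples of
   m > 0 take one that meets as few classes as possible: inside it, no class of nonzero density is of
   the latter kind, so each of them takes care of all large n.  It remains to find a solution of the
   first few equations within one class of nonzero density and with y divisible by all the moduli;
   this is Brauer's theorem on a dilate of {1..M} that avoids the classes of density zero. *)
theory Submission
  imports Defs "HOL-Library.Countable" "HOL-Library.Infinite_Set"
begin

section \<open>Monochromatic progressions by colour focusing, then progressions sharing the colour
  of their difference\<close>

section \<open>The theorems of van der Waerden and Brauer\<close>

(* The progression is f + d, ..., f + k * d; that its focus f lies in range as well costs nothing
   and is what the colour focusing argument needs. *)
definition vdw_bound :: "nat \<Rightarrow> nat set \<Rightarrow> nat \<Rightarrow> bool" where
  "vdw_bound k C W \<longleftrightarrow>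
     (\<forall>col. col ` {..<W} \<subseteq> C \<longrightarrow>
        (\<exists>f d c. d > 0 \<and> f + k * d < W \<and> (\<forall>j\<in>{1..k}. col (f + j * d) = c)))"

text \<open>Induction on s, the number of differently coloured progressions sharing the focus f.
  Blocks of length W, coloured by their words of colours, contain k equal blocks in progression,
  with a block F as focus. Inside one of them lie s focused progressions. Either the colour of their
  focus extends one of them to k + 1 terms, or stretching them across the blocks gives s + 1 colours
  focused in block F.\<close>

lemma colour_focusing:
  fixes k s :: nat and C :: "nat set"
  assumes IH: "\<And>C. finite C \<Longrightarrow> \<exists>W. vdw_bound k C W" and C: "finite C"
  shows "\<exists>W. \<forall>col. col ` {..<W} \<subseteq> C \<longrightarrow>
           (\<exists>f d. d > 0 \<and> f + k * d < W \<and> (\<forall>j\<le>k. col (f + j * d) = col f)) \<or>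
           (\<exists>f E. f < W \<and> finite E \<and> card E = s \<and>
              (\<forall>c\<in>E. \<exists>d>0. f + k * d < W \<and> (\<forall>j\<in>{1..k}. col (f + j * d) = c)))"
proof (induction s)
  case 0
  show ?case
  proof (rule exI[of _ "1::nat"], intro allI impI disjI2)
    fix col :: "nat \<Rightarrow> nat"
    show "\<exists>f E. f < 1 \<and> finite E \<and> card E = 0 \<and>
      (\<forall>c\<in>E. \<exists>d>0. f + k * d < 1 \<and> (\<forall>j\<in>{1..k}. col (f + j * d) = c))"
      by (rule exI[of _ "0::nat"], rule exI[of _ "{}"]) auto
  qed
next
  case (Suc s)
  then obtain W where W: "\<And>col. col ` {..<W} \<subseteq> C \<Longrightarrow>
           (\<exists>f d. d > 0 \<and> f + k * d < W \<and> (\<forall>j\<le>k. col (f + j * d) = col f)) \<or>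
           (\<exists>f E. f < W \<and> finite E \<and> card E = s \<and>
              (\<forall>c\<in>E. \<exists>d>0. f + k * d < W \<and> (\<forall>j\<in>{1..k}. col (f + j * d) = c)))"
    by blast
  \<comment> \<open>Colours are natural numbers, so the word of colours on a block is coded by
    \<open>to_nat\<close>; injectivity of the coding recovers the word.\<close>
  define C' where "C' = to_nat ` {l :: nat list. set l \<subseteq> C \<and> length l = W}"
  have "finite C'"
    unfolding C'_def using C by (intro finite_imageI finite_lists_length_eq)
  then obtain N where N: "vdw_bound k C' N"
    using IH by blast
  show ?case
  proof (intro exI[of _ "N * W"] allI impI)
    fix col :: "nat \<Rightarrow> nat"
    assume col: "col ` {..<N * W} \<subseteq> C"
    have less: "i * W + t < N * W" if "i < N" "t < W" for i t
    proof -
      have "i * W + t < Suc i * W" using that by simp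
      also have "\<dots> \<le> N * W" using that by (intro mult_le_mono1) auto
      finally show ?thesis .
    qed
    define b where "b i = to_nat (map (\<lambda>t. col (i * W + t)) [0..<W])" for i
    have bC: "b ` {..<N} \<subseteq> C'"
    proof (rule image_subsetI)
      fix i assume "i \<in> {..<N}"
      then have "col (i * W + t) \<in> C" if "t < W" for t
        using col less[of i t] that by blast
      then show "b i \<in> C'"
        unfolding b_def C'_def by (intro imageI) auto
    qed
    obtain F D e where D: "D > 0" and FN: "F + k * D < N"
      and e: "\<And>j. j \<in> {1..k} \<Longrightarrow> b (F + j * D) = e"
      using N[unfolded vdw_bound_def, rule_format, OF bC] by metis
    \<comment> \<open>Blocks F + D, ..., F + k * D carry the same word; nothing is known about the
      focus block F.\<close>
    have blk: "col ((F + j * D) * W + t) = col ((F + D) * W + t)"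
      if "j \<in> {1..k}" "t < W" for j t
    proof -
      have "b (F + j * D) = b (F + 1 * D)"
        using e[of j] e[of 1] that by auto
      then have "map (\<lambda>t. col ((F + j * D) * W + t)) [0..<W] =
          map (\<lambda>t. col ((F + 1 * D) * W + t)) [0..<W]"
        unfolding b_def by (rule injD[OF inj_to_nat])
      then show ?thesis using that by simp
    qed
    show "(\<exists>f d. d > 0 \<and> f + k * d < N * W \<and> (\<forall>j\<le>k. col (f + j * d) = col f)) \<or>
           (\<exists>f E. f < N * W \<and> finite E \<and> card E = Suc s \<and>
              (\<forall>c\<in>E. \<exists>d>0. f + k * d < N * W \<and> (\<forall>j\<in>{1..k}. col (f + j * d) = c)))"
    \<comment> \<open>For k = 0 the block F + D may lie out of range, but then a single term already
      satisfies the first alternative.\<close>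
    proof (cases "k = 0")
      case True
      have "N > 0" using FN by simp
      show ?thesis
      proof (cases "W = 0")
        case True
        then show ?thesis using W[of col] by auto
      next
        case False
        with \<open>N > 0\<close> have "0 + k * 1 < N * W" using \<open>k = 0\<close> by simp
        then show ?thesis using \<open>k = 0\<close>
          by (intro disjI1 exI[of _ "0::nat"] exI[of _ "1::nat"]) auto
      qed
    next
      case False
      have "F + 1 * D \<le> F + k * D"
        using False by (intro add_left_mono mult_le_mono1) auto
      then have FD: "F + D < N" using FN by linarith
      let ?col = "\<lambda>t. col ((F + D) * W + t)"
      have "?col ` {..<W} \<subseteq> C"
        using col less[OF FD] by auto
      from W[OF this] consider
          (mono) f d where "d > 0 \<and> f + k * d < W \<and> (\<forall>j\<le>k. ?col (f + j * d) = ?col f)"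
        | (foc) f E where "f < W \<and> finite E \<and> card E = s \<and>
            (\<forall>c\<in>E. \<exists>d>0. f + k * d < W \<and> (\<forall>j\<in>{1..k}. ?col (f + j * d) = c))"
        by (elim disjE exE) (rule that, assumption)+
      then show ?thesis
      proof cases
        case mono
        then have "(F + D) * W + f + k * d < N * W"
          using less[OF FD, of "f + k * d"] by (simp add: add.assoc)
        with mono show ?thesis
          by (intro disjI1 exI[of _ "(F + D) * W + f"] exI[of _ d]) (auto simp: add.assoc)
      next
        case foc
        then have foc: "f < W" "finite E" "card E = s"
          "\<And>c. c \<in> E \<Longrightarrow> \<exists>d>0. f + k * d < W \<and> (\<forall>j\<in>{1..k}. ?col (f + j * d) = c)"
          by simp_all
        show ?thesis
        proof (cases "?col f \<in> E")
          case True
          then obtain d where d: "d > 0" "f + k * d < W"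
            "\<And>j. j \<in> {1..k} \<Longrightarrow> ?col (f + j * d) = ?col f"
            using foc(4) by blast
          have "?col (f + j * d) = ?col f" if "j \<le> k" for j
            using d(3)[of j] that by (cases "j = 0") auto
          moreover have "(F + D) * W + f + k * d < N * W"
            using less[OF FD, of "f + k * d"] d by (simp add: add.assoc)
          ultimately show ?thesis using d(1)
            by (intro disjI1 exI[of _ "(F + D) * W + f"] exI[of _ d]) (auto simp: add.assoc)
        next
          case False
          \<comment> \<open>With difference d + D * W and focus moved to block F, the j-th term lies
            in block F + j * D at offset f + j * d, so it has the old colour. The case d = 0 is
            allowed: it turns the copies of the old focus into the progression of the new
            colour.\<close>
          have *: "\<exists>d>0. F * W + f + k * d < N * W \<and>
              (\<forall>j\<in>{1..k}. col (F * W + f + j * d) = c)"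
            if "f + k * d < W" "\<And>j. j \<in> {1..k} \<Longrightarrow> ?col (f + j * d) = c" for d c
          proof (intro exI[of _ "d + D * W"] conjI ballI)
            have "W > 0" using that by simp
            then show "d + D * W > 0" using D by simp
            have eq: "F * W + f + j * (d + D * W) = (F + j * D) * W + (f + j * d)" for j
              by (simp add: algebra_simps)
            show "F * W + f + k * (d + D * W) < N * W"
              unfolding eq using less[OF FN that(1)] .
            fix j assume j: "j \<in> {1..k}"
            then have "j * d \<le> k * d" by (intro mult_le_mono1) auto
            then have "f + j * d < W" using that(1) by linarith
            then show "col (F * W + f + j * (d + D * W)) = c"
              unfolding eq using blk[OF j] that(2)[OF j] by simp
          qed
          have "\<exists>d>0. F * W + f + k * d < N * W \<and>
              (\<forall>j\<in>{1..k}. col (F * W + f + j * d) = c)" if "c \<in> insert (?col f) E" for c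
          proof (cases "c = ?col f")
            case True
            then show ?thesis using *[of 0 c] foc(1) by simp
          next
            case False
            then show ?thesis using foc(4)[of c] that * by blast
          qed
          moreover have "F * W + f < N * W"
            using less[of F f] foc(1) FD by simp
          moreover have "card (insert (?col f) E) = Suc s"
            using foc False by simp
          ultimately show ?thesis using foc(2)
            by (intro disjI2 exI[of _ "F * W + f"] exI[of _ "insert (?col f) E"]) blast
        qed
      qed
    qed
  qed
qed

text \<open>Focusing is run for one more colour than C has. As k > 0, each focused colour is
  attained inside the range and so belongs to C; hence only the monochromatic alternative
  survives.\<close>

lemma vdw_step:
  fixes C :: "nat set"
  assumes "\<And>C. finite C \<Longrightarrow> \<exists>W. vdw_bound k C W" and "finite C" and "k > 0"
  shows "\<exists>W. \<forall>col. col ` {..<W} \<subseteq> C \<longrightarrow>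
           (\<exists>f d. d > 0 \<and> f + k * d < W \<and> (\<forall>j\<le>k. col (f + j * d) = col f))"
proof -
  obtain W where W: "\<And>col. col ` {..<W} \<subseteq> C \<Longrightarrow>
           (\<exists>f d. d > 0 \<and> f + k * d < W \<and> (\<forall>j\<le>k. col (f + j * d) = col f)) \<or>
           (\<exists>f E. f < W \<and> finite E \<and> card E = Suc (card C) \<and>
              (\<forall>c\<in>E. \<exists>d>0. f + k * d < W \<and> (\<forall>j\<in>{1..k}. col (f + j * d) = c)))"
    using colour_focusing[OF assms(1,2), of "Suc (card C)"] by blast
  have "\<exists>f d. d > 0 \<and> f + k * d < W \<and> (\<forall>j\<le>k. col (f + j * d) = col f)"
    if col: "col ` {..<W} \<subseteq> C" for col
  proof (rule ccontr)
    assume "\<not> ?thesis"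
    then obtain f E where E: "card E = Suc (card C)"
      "\<And>c. c \<in> E \<Longrightarrow> \<exists>d>0. f + k * d < W \<and> (\<forall>j\<in>{1..k}. col (f + j * d) = c)"
      using W[OF col] by meson
    have "E \<subseteq> C"
    proof
      fix c assume "c \<in> E"
      then obtain d where "f + k * d < W" "\<forall>j\<in>{1..k}. col (f + j * d) = c"
        using E(2) by blast
      then have "col (f + k * d) = c" "f + k * d \<in> {..<W}" using \<open>k > 0\<close> by auto
      then show "c \<in> C" using col by blast
    qed
    then have "card E \<le> card C" using assms(2) by (rule card_mono[rotated])
    then show False using E(1) by simp
  qed
  then show ?thesis by blast
qed

text \<open>Induction on k: \<open>vdw_step\<close> turns k terms with a focus into k + 1 terms
  starting at f. The next round needs the point f - d as a focus, so the step is applied to the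
  second half of an interval of length 2 * W, where d \<le> W leaves room for it.\<close>

lemma ex_vdw_bound:
  assumes "finite C"
  shows "\<exists>W. vdw_bound k C W"
  using assms
proof (induction k arbitrary: C)
  case 0
  show ?case by (rule exI[of _ 1]) (auto simp: vdw_bound_def)
next
  case (Suc k)
  show ?case
  proof (cases "k = 0")
    case True
    have "vdw_bound (Suc k) C 2"
      unfolding vdw_bound_def True
      by (intro allI impI, rule exI[of _ "0::nat"], rule exI[of _ "1::nat"]) auto
    then show ?thesis by blast
  next
    case False
    then obtain W where W: "\<And>col. col ` {..<W} \<subseteq> C \<Longrightarrow>
           (\<exists>f d. d > 0 \<and> f + k * d < W \<and> (\<forall>j\<le>k. col (f + j * d) = col f))"
      using vdw_step[OF Suc.IH Suc.prems] by blast
    have "vdw_bound (Suc k) C (W + W)"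
      unfolding vdw_bound_def
    proof (intro allI impI)
      fix col :: "nat \<Rightarrow> nat"
      assume "col ` {..<W + W} \<subseteq> C"
      then have "(\<lambda>x. col (W + x)) ` {..<W} \<subseteq> C" by auto
      from W[OF this] obtain f d where fd: "d > 0" "f + k * d < W"
        "\<And>j. j \<le> k \<Longrightarrow> col (W + (f + j * d)) = col (W + f)" by blast
      have "1 * d \<le> k * d" using False by (intro mult_le_mono1) auto
      then have "d \<le> W" using fd(2) by linarith
      have shift: "W + f - d + Suc j * d = W + (f + j * d)" for j
        using \<open>d \<le> W\<close> by simp
      have "col (W + f - d + j * d) = col (W + f)" if j: "j \<in> {1..Suc k}" for j
      proof -
        obtain i where "j = Suc i" "i \<le> k" using j by (cases j) auto
        then show ?thesis using shift[of i] fd(3)[of i] by metis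
      qed
      then show "\<exists>f d c. d > 0 \<and> f + Suc k * d < W + W \<and> (\<forall>j\<in>{1..Suc k}. col (f + j * d) = c)"
        using fd(1,2) shift[of k]
        by (intro exI[of _ "W + f - d"] exI[of _ d] exI[of _ "col (W + f)"]) auto
    qed
    then show ?thesis by blast
  qed
qed

theorem van_der_Waerden:
  assumes "finite C"
  obtains W where "\<And>col :: nat \<Rightarrow> nat. col ` {..<W} \<subseteq> C \<Longrightarrow>
           \<exists>a d. d > 0 \<and> a + k * d < W \<and> (\<forall>j\<le>k. col (a + j * d) = col a)"
proof (cases "k = 0")
  case True
  show ?thesis
    by (rule that[of 1]) (auto simp: True)
next
  case False
  then show ?thesis
    using vdw_step[OF ex_vdw_bound assms] that by blast
qed

text \<open>Induction on the number of colours. Take a long progression of colour c with difference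
  d. If a small multiple y * d also has colour c, the progression contains a shorter one with
  difference y * d. Otherwise the small multiples of d avoid c, and the induction hypothesis applies
  to them after division by d.\<close>

theorem Brauer:
  assumes "finite C"
  shows "\<exists>M. \<forall>col :: nat \<Rightarrow> nat. col ` {1..M} \<subseteq> C \<longrightarrow>
           (\<exists>a y. a > 0 \<and> y > 0 \<and> y \<le> M \<and> a + L * y \<le> M \<and> (\<forall>j\<le>L. col (a + j * y) = col y))"
  using assms
proof (induction "card C" arbitrary: C)
  case 0
  then show ?case by (intro exI[of _ 1]) auto
next
  case (Suc s)
  have "\<exists>M. \<forall>col. col ` {1..M} \<subseteq> C - {c} \<longrightarrow>
        (\<exists>a y. a > 0 \<and> y > 0 \<and> y \<le> M \<and> a + L * y \<le> M \<and> (\<forall>j\<le>L. col (a + j * y) = col y))"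
    if "c \<in> C" for c
    using Suc that by (intro Suc.hyps(1)) auto
  then obtain m where m: "\<And>c col. c \<in> C \<Longrightarrow> col ` {1..m c} \<subseteq> C - {c} \<Longrightarrow>
        \<exists>a y. a > 0 \<and> y > 0 \<and> y \<le> m c \<and> a + L * y \<le> m c \<and> (\<forall>j\<le>L. col (a + j * y) = col y)"
    by metis
  define M where "M = sum m C"
  have mM: "m c \<le> M" if "c \<in> C" for c
    unfolding M_def using that Suc.prems by (intro member_le_sum) auto
  \<comment> \<open>The length L * M leaves room for L steps of size y * d with y \<le> M. The extra
    term ensures d < W even if L * M = 0, so all multiples of d considered below stay within M *
    W.\<close>
  obtain W where W: "\<And>col. col ` {..<W} \<subseteq> C \<Longrightarrow>
           \<exists>a d. d > 0 \<and> a + (L * M + 1) * d < W \<and> (\<forall>j\<le>L * M + 1. col (a + j * d) = col a)"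
    using van_der_Waerden[OF Suc.prems] by blast
  show ?case
  proof (rule exI[of _ "W + M * W"], intro allI impI)
    fix col :: "nat \<Rightarrow> nat"
    assume col: "col ` {1..W + M * W} \<subseteq> C"
    then have "(\<lambda>x. col (Suc x)) ` {..<W} \<subseteq> C" by auto
    from W[OF this] obtain a0 d where ad: "d > 0" "a0 + (L * M + 1) * d < W"
      "\<And>j. j \<le> L * M + 1 \<Longrightarrow> col (Suc a0 + j * d) = col (Suc a0)"
      by auto
    define a where "a = Suc a0"
    define c where "c = col a"
    have aW: "a + (L * M) * d \<le> W" and dW: "d \<le> W"
      using ad(2) by (auto simp: a_def)
    have "a \<in> {1..W + M * W}" using aW by (auto simp: a_def)
    then have "c \<in> C" using col unfolding c_def by blast
    show "\<exists>a y. a > 0 \<and> y > 0 \<and> y \<le> W + M * W \<and> a + L * y \<le> W + M * W \<and>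
        (\<forall>j\<le>L. col (a + j * y) = col y)"
    proof (cases "\<exists>y\<in>{1..m c}. col (y * d) = c")
      case True
      then obtain y where y: "y \<in> {1..m c}" "col (y * d) = c" by blast
      then have yM: "y \<le> M" using mM[OF \<open>c \<in> C\<close>] by simp
      have "y * d \<le> M * W" using yM dW by (intro mult_le_mono)
      moreover have "a + L * (y * d) \<le> W"
      proof -
        have "L * y * d \<le> L * M * d" using yM by (intro mult_le_mono) auto
        then show ?thesis using aW by (simp only: mult.assoc)
      qed
      moreover have "col (a + j * (y * d)) = col (y * d)" if "j \<le> L" for j
        using ad(3)[of "j * y"] mult_le_mono[OF that yM] y(2)
        by (simp add: a_def c_def mult.assoc)
      ultimately show ?thesis using y(1) ad(1)
        by (intro exI[of _ a] exI[of _ "y * d"]) (auto simp: a_def)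
    next
      case False
      have le: "j * d \<le> W + M * W" if "j \<le> m c" for j
        using mult_le_mono[OF order.trans[OF that mM[OF \<open>c \<in> C\<close>]] dW] by simp
      have "(\<lambda>j. col (j * d)) ` {1..m c} \<subseteq> C - {c}"
      proof (intro image_subsetI DiffI)
        fix j assume j: "j \<in> {1..m c}"
        then have "j * d \<in> {1..W + M * W}" using le[of j] ad(1) by auto
        then show "col (j * d) \<in> C" using col by blast
        show "col (j * d) \<notin> {c}" using False j by blast
      qed
      from m[OF \<open>c \<in> C\<close> this] obtain a' y' where *: "a' > 0" "y' > 0" "y' \<le> m c"
        "a' + L * y' \<le> m c" "\<And>j. j \<le> L \<Longrightarrow> col ((a' + j * y') * d) = col (y' * d)"
        by blast
      show ?thesis
        using * ad(1) le[of y'] le[of "a' + L * y'"]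
        by (intro exI[of _ "a' * d"] exI[of _ "y' * d"]) (auto simp: algebra_simps)
    qed
  qed
qed

section \<open>Natural density zero: a dilation-stable ideal, and pigeonhole outside it\<close>

section \<open>Sets of density zero\<close>

text \<open>Natural density zero without real numbers: the proportion in {1..N} is eventually at
  most 1/q. Its negation is positive upper density.\<close>

definition density_zero :: "nat set \<Rightarrow> bool" where
  "density_zero A \<longleftrightarrow> (\<forall>q. \<exists>N0. \<forall>N\<ge>N0. q * card (A \<inter> {1..N}) \<le> N)"

lemma density_zero_finite:
  assumes "finite A"
  shows "density_zero A"
  unfolding density_zero_def
proof (intro allI exI impI)
  fix q N :: nat
  assume "q * card A \<le> N"
  moreover have "card (A \<inter> {1..N}) \<le> card A"
    using assms by (intro card_mono) auto
  ultimately show "q * card (A \<inter> {1..N}) \<le> N"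
    using le_trans mult_le_mono2 by blast
qed

lemma density_zero_Un:
  assumes "density_zero A" "density_zero B"
  shows "density_zero (A \<union> B)"
  unfolding density_zero_def
proof
  fix q
  obtain N1 N2 where N: "\<And>N. N \<ge> N1 \<Longrightarrow> 2 * q * card (A \<inter> {1..N}) \<le> N"
    "\<And>N. N \<ge> N2 \<Longrightarrow> 2 * q * card (B \<inter> {1..N}) \<le> N"
    using assms unfolding density_zero_def by meson
  show "\<exists>N0. \<forall>N\<ge>N0. q * card ((A \<union> B) \<inter> {1..N}) \<le> N"
  proof (intro exI[of _ "max N1 N2"] allI impI)
    fix N assume "N \<ge> max N1 N2"
    then have "2 * q * card (A \<inter> {1..N}) \<le> N" "2 * q * card (B \<inter> {1..N}) \<le> N"
      using N by auto
    moreover have "q * card ((A \<union> B) \<inter> {1..N}) \<le> q * (card (A \<inter> {1..N}) + card (B \<inter> {1..N}))"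
      unfolding Int_Un_distrib2 by (intro mult_le_mono2 card_Un_le)
    ultimately show "q * card ((A \<union> B) \<inter> {1..N}) \<le> N"
      by (simp add: algebra_simps)
  qed
qed

lemma density_zero_UN:
  assumes "finite I" "\<And>i. i \<in> I \<Longrightarrow> density_zero (A i)"
  shows "density_zero (\<Union>i\<in>I. A i)"
  using assms by (induction I) (auto simp: density_zero_Un density_zero_finite)

text \<open>Multiplication by x embeds the part up to N into A up to N * x, so proportions grow at
  most by the factor x; hence q * x is used for A.\<close>

lemma density_zero_dilate:
  assumes "density_zero A" "x > 0"
  shows "density_zero {t. t * x \<in> A}"
  unfolding density_zero_def
proof
  fix q
  obtain N0 where N0: "\<And>N. N \<ge> N0 \<Longrightarrow> q * x * card (A \<inter> {1..N}) \<le> N"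
    using assms unfolding density_zero_def by meson
  show "\<exists>N0. \<forall>N\<ge>N0. q * card ({t. t * x \<in> A} \<inter> {1..N}) \<le> N"
  proof (intro exI[of _ N0] allI impI)
    fix N assume "N \<ge> N0"
    then have "N0 \<le> N * x" using assms(2) by (metis le_trans mult_le_mono2 nat_mult_1_right less_eq_Suc_le One_nat_def)
    have "card ({t. t * x \<in> A} \<inter> {1..N}) \<le> card (A \<inter> {1..N * x})"
      using assms(2) by (intro card_inj_on_le[of "\<lambda>t. t * x"]) (auto simp: inj_on_def)
    then have "q * x * card ({t. t * x \<in> A} \<inter> {1..N}) \<le> N * x"
      using N0[OF \<open>N0 \<le> N * x\<close>] le_trans mult_le_mono2 by blast
    then have "(q * card ({t. t * x \<in> A} \<inter> {1..N})) * x \<le> N * x"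
      by (simp add: mult_ac)
    then show "q * card ({t. t * x \<in> A} \<inter> {1..N}) \<le> N"
      using assms(2) by simp
  qed
qed

lemma density_zero_avoid:
  assumes "density_zero A"
  shows "\<exists>t>0. t \<notin> A"
proof (rule ccontr)
  assume "\<not> ?thesis"
  then have "t \<in> A" if "t \<ge> 1" for t
    using that by (metis less_le_trans zero_less_one)
  then have A: "{1..N} \<subseteq> A" for N by auto
  obtain N0 where "\<forall>N\<ge>N0. 2 * card (A \<inter> {1..N}) \<le> N"
    using assms unfolding density_zero_def by blast
  then have "2 * card (A \<inter> {1..Suc N0}) \<le> Suc N0" by simp
  then show False by (simp only: Int_absorb1[OF A] card_atLeastAtMost)
qed

text \<open>The bad t form a finite union of preimages of A under dilations, which has density zero
  and so omits a positive integer.\<close>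

lemma density_zero_avoid_dilate:
  assumes "density_zero A" "finite F" "\<And>x. x \<in> F \<Longrightarrow> x > 0"
  obtains t where "t > 0" "\<And>x. x \<in> F \<Longrightarrow> t * x \<notin> A"
proof -
  have "density_zero (\<Union>x\<in>F. {t. t * x \<in> A})"
    using assms by (intro density_zero_UN density_zero_dilate) auto
  from density_zero_avoid[OF this] obtain t where "t > 0" "t \<notin> (\<Union>x\<in>F. {t. t * x \<in> A})"
    by blast
  then show ?thesis using that[of t] by blast
qed

text \<open>Pigeonhole: if A has more than N / q elements up to N for arbitrarily large N, more than
  2 * q pairwise disjoint translates would not fit into an interval of length about N.\<close>

lemma translates_meet:
  assumes "\<not> density_zero A"
  obtains K where "\<And>S :: int set. finite S \<Longrightarrow> card S > K \<Longrightarrow>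
    \<exists>s\<in>S. \<exists>t\<in>S. s \<noteq> t \<and> (\<exists>a\<in>A. \<exists>b\<in>A. s + int a = t + int b)"
proof -
  obtain q where q: "\<And>N0. \<exists>N\<ge>N0. N < q * card (A \<inter> {1..N})"
    using assms unfolding density_zero_def by (meson not_le)
  show ?thesis
  proof (rule that[of "2 * q"], rule ccontr)
    fix S :: "int set"
    assume S: "finite S" "card S > 2 * q"
      and neg: "\<not> (\<exists>s\<in>S. \<exists>t\<in>S. s \<noteq> t \<and> (\<exists>a\<in>A. \<exists>b\<in>A. s + int a = t + int b))"
    define B where "B = (\<Sum>s\<in>S. nat \<bar>s\<bar>)"
    have B: "\<bar>s\<bar> \<le> int B" if "s \<in> S" for s
    proof -
      have "nat \<bar>s\<bar> \<le> B" unfolding B_def using that S(1) by (intro member_le_sum) auto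
      then show ?thesis by linarith
    qed
    \<comment> \<open>N is so large that the interval containing all translates has N + 2 * B + 1
      \<le> 2 * N elements.\<close>
    obtain N where N: "N \<ge> 2 * B + 1" "N < q * card (A \<inter> {1..N})"
      using q by blast
    have "card (S \<times> (A \<inter> {1..N})) \<le> card {- int B..int N + int B}"
    proof (rule card_inj_on_le[of "\<lambda>(s, a). s + int a"])
      show "inj_on (\<lambda>(s, a). s + int a) (S \<times> (A \<inter> {1..N}))"
      proof (rule inj_onI, clarify)
        fix s a t b
        assume "s \<in> S" "t \<in> S" "a \<in> A" "b \<in> A" and eq: "s + int a = t + int b"
        then have "s = t" using neg by blast
        then show "s = t \<and> a = b" using eq by simp
      qed
      show "(\<lambda>(s, a). s + int a) ` (S \<times> (A \<inter> {1..N})) \<subseteq> {- int B..int N + int B}"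
        using B by (fastforce simp: abs_le_iff)
    qed simp
    then have "card S * card (A \<inter> {1..N}) \<le> 2 * N"
      using N(1) by (simp add: card_cartesian_product)
    moreover have "2 * q * card (A \<inter> {1..N}) \<le> card S * card (A \<inter> {1..N})"
      using S(2) by (intro mult_le_mono1) simp
    ultimately have "2 * (q * card (A \<inter> {1..N})) \<le> 2 * N"
      by (metis le_trans mult.assoc)
    then show False using N(2) by linarith
  qed
qed

section \<open>Sumsets of a set of positive upper density fill residue classes, so single equations
  become solvable\<close>

section \<open>Iterated sumsets\<close>

primrec sumset :: "nat \<Rightarrow> int set \<Rightarrow> int set" where
  "sumset 0 X = {0}"
| "sumset (Suc n) X = {s + x |s x. s \<in> sumset n X \<and> x \<in> X}"

lemma sumset_mono:
  assumes "0 \<in> X" "m \<le> n"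
  shows "sumset m X \<subseteq> sumset n X"
  using assms(2)
proof (induction rule: dec_induct)
  case (step n)
  moreover have "sumset n X \<subseteq> sumset (Suc n) X"
    using assms(1) by force
  ultimately show ?case by blast
qed simp

lemma sumset_add:
  assumes "s \<in> sumset m X" "t \<in> sumset n X"
  shows "s + t \<in> sumset (m + n) X"
  using assms(2)
proof (induction n arbitrary: t)
  case 0
  then show ?case using assms(1) by simp
next
  case (Suc n)
  then obtain t' x where t: "t = t' + x" "t' \<in> sumset n X" "x \<in> X" by auto
  then have "(s + t') + x \<in> sumset (Suc (m + n)) X"
    using Suc.IH[of t'] by auto
  then show ?case unfolding t(1) add_Suc_right by (simp only: add.assoc)
qed

lemma sumset_iff_sum:
  "s \<in> sumset n X \<longleftrightarrow> (\<exists>x. (\<forall>j\<in>{1..n}. x j \<in> X) \<and> s = (\<Sum>j=1..n. x j))"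
proof (induction n arbitrary: s)
  case (Suc n)
  show ?case
  proof
    assume "s \<in> sumset (Suc n) X"
    then obtain t y where t: "s = t + y" "t \<in> sumset n X" "y \<in> X" by auto
    then obtain x where "\<forall>j\<in>{1..n}. x j \<in> X" "t = (\<Sum>j=1..n. x j)"
      using Suc.IH by blast
    then show "\<exists>x. (\<forall>j\<in>{1..Suc n}. x j \<in> X) \<and> s = (\<Sum>j=1..Suc n. x j)"
      using t by (intro exI[of _ "x(Suc n := y)"]) auto
  next
    assume "\<exists>x. (\<forall>j\<in>{1..Suc n}. x j \<in> X) \<and> s = (\<Sum>j=1..Suc n. x j)"
    then obtain x where x: "\<forall>j\<in>{1..Suc n}. x j \<in> X" "s = (\<Sum>j=1..n. x j) + x (Suc n)"
      by auto
    then have "\<forall>j\<in>{1..n}. x j \<in> X" by auto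
    then have "(\<Sum>j=1..n. x j) \<in> sumset n X"
      using Suc.IH by blast
    moreover have "x (Suc n) \<in> X" using x by simp
    ultimately show "s \<in> sumset (Suc n) X" unfolding sumset.simps x(2) by blast
  qed
qed auto

text \<open>Elements of both signs make the submonoid a group: -h is a nonnegative combination of h
  and an element of opposite sign. The least positive element then generates it.\<close>

lemma int_submonoid_eq_multiples:
  fixes H :: "int set"
  assumes "0 \<in> H" and add: "\<And>g h. g \<in> H \<Longrightarrow> h \<in> H \<Longrightarrow> g + h \<in> H"
    and p: "p \<in> H" "p > 0" and q: "q \<in> H" "q < 0"
  obtains m :: nat where "m > 0" "\<And>h. h \<in> H \<longleftrightarrow> int m dvd h"
proof -
  have nmult: "int k * h \<in> H" if "h \<in> H" for k h
    by (induction k) (use assms(1) that add in \<open>auto simp: algebra_simps\<close>)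
  have neg: "- h \<in> H" if h: "h \<in> H" for h
  proof (cases "h > 0")
    case True
    have "- h = int (nat (- q - 1)) * h + int (nat h) * q"
      using True q by (simp add: algebra_simps)
    then show ?thesis using add nmult h q by metis
  next
    case False
    have "- h = int (nat (- h)) * p + int (nat (p - 1)) * h"
      using False p by (simp add: algebra_simps)
    then show ?thesis using add nmult h p by metis
  qed
  have mult: "k * h \<in> H" if "h \<in> H" for k h
    using nmult[OF that, of "nat \<bar>k\<bar>"] neg[of "\<bar>k\<bar> * h"] by (cases "k \<ge> 0") auto
  define m where "m = (LEAST m. m > 0 \<and> int m \<in> H)"
  have m: "m > 0" "int m \<in> H"
    using LeastI[of "\<lambda>m. m > 0 \<and> int m \<in> H" "nat p"] p unfolding m_def by auto
  have "int m dvd h" if "h \<in> H" for h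
  proof -
    have "h mod int m = h + (- (h div int m)) * int m"
      by (simp add: minus_div_mult_eq_mod [symmetric])
    then have "h mod int m \<in> H" using add that mult m by metis
    moreover have "h mod int m < int m" "h mod int m \<ge> 0" using m(1) by auto
    ultimately have "\<not> nat (h mod int m) > 0"
      using not_less_Least[of "nat (h mod int m)" "\<lambda>m. m > 0 \<and> int m \<in> H"]
      unfolding m_def[symmetric] by auto
    then show ?thesis using \<open>h mod int m \<ge> 0\<close> by auto
  qed
  moreover have "h \<in> H" if "int m dvd h" for h
    using that mult m by (auto simp: mult.commute)
  ultimately show ?thesis using that m(1) by blast
qed

text \<open>Let X = A - a and let H be the monoid it generates, which is the set of multiples of
  some m. A largest finite S in H with pairwise disjoint translates s + A exists by
  \<open>translates_meet\<close>. By maximality every u + A with u in H meets some s + A, so H lies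
  in S + X - X; being finite, S lies in one iterated sumset.\<close>

lemma sumset_minus_stabilizes:
  assumes A: "\<not> density_zero A"
  obtains a m n0 where "a \<in> A" "m > 0" "\<And>b. b \<in> A \<Longrightarrow> int m dvd int b - int a"
    "\<And>n u. n \<ge> n0 \<Longrightarrow> int m dvd u \<Longrightarrow>
       \<exists>s\<in>sumset n ((\<lambda>b. int b - int a) ` A). \<exists>z\<in>A. u = s - (int z - int a)"
proof -
  have inf: "infinite A" using A density_zero_finite by blast
  \<comment> \<open>The base point a lies strictly between two elements of A, so that X has elements
    of both signs and H is a group.\<close>
  then obtain p a q where paq: "p \<in> A" "a \<in> A" "q \<in> A" "p < a" "a < q"
    by (meson infinite_nat_iff_unbounded)
  define X where "X = (\<lambda>b. int b - int a) ` A"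
  have X0: "0 \<in> X" using paq unfolding X_def by force
  define H where "H = (\<Union>n. sumset n X)"
  have XH: "X \<subseteq> H"
    unfolding H_def by (auto intro!: exI[of _ "Suc 0"])
  have add: "g + h \<in> H" if "g \<in> H" "h \<in> H" for g h
    using that sumset_add unfolding H_def by blast
  have "int q - int a \<in> H" "int p - int a \<in> H" "0 \<in> H"
    using XH X0 paq unfolding X_def by auto
  then obtain m where m: "m > 0" "\<And>h. h \<in> H \<longleftrightarrow> int m dvd h"
    using int_submonoid_eq_multiples[of H "int q - int a" "int p - int a"] add paq
    by (metis diff_gt_0_iff_gt diff_less_0_iff_less of_nat_less_iff)
  obtain K where K: "\<And>S :: int set. finite S \<Longrightarrow> card S > K \<Longrightarrow>
    \<exists>s\<in>S. \<exists>t\<in>S. s \<noteq> t \<and> (\<exists>a\<in>A. \<exists>b\<in>A. s + int a = t + int b)"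
    using translates_meet[OF A] by blast
  define P where "P S \<longleftrightarrow> finite S \<and> S \<subseteq> H \<and>
    (\<forall>s\<in>S. \<forall>t\<in>S. s \<noteq> t \<longrightarrow> (\<forall>a\<in>A. \<forall>b\<in>A. s + int a \<noteq> t + int b))" for S
  have "card S \<le> K" if "P S" for S
  proof (rule ccontr)
    assume "\<not> ?thesis"
    with K[of S] that show False unfolding P_def by auto
  qed
  moreover have "P {}" unfolding P_def by simp
  ultimately have "\<exists>S. P S \<and> (\<forall>T. P T \<longrightarrow> card T \<le> card S)"
    by (intro ex_has_greatest_nat[of P "{}" card "Suc K"]) (auto simp: le_imp_less_Suc)
  then obtain S where S: "P S" "\<And>T. P T \<Longrightarrow> card T \<le> card S"
    by metis
  have fin: "finite S" and "S \<subseteq> H" using S(1) unfolding P_def by auto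
  then have "\<exists>n. S \<subseteq> sumset n X"
  proof (induction S)
    case (insert h S)
    then obtain n n' where "S \<subseteq> sumset n X" "h \<in> sumset n' X"
      unfolding H_def by auto
    then have "insert h S \<subseteq> sumset (max n n') X"
      using sumset_mono[OF X0, of n "max n n'"] sumset_mono[OF X0, of n' "max n n'"] by auto
    then show ?case by blast
  qed simp
  then obtain n0 where n0: "S \<subseteq> sumset n0 X" by blast
  \<comment> \<open>One summand beyond \<open>n0\<close> is needed for b - a; further summands can
    be 0, which lies in X.\<close>
  have "\<exists>s\<in>sumset n X. \<exists>z\<in>A. u = s - (int z - int a)" if n: "n \<ge> Suc n0" and "int m dvd u" for n u
  proof -
    have u: "u \<in> H" using that m by blast
    have "\<exists>s\<in>S. \<exists>b\<in>A. \<exists>z\<in>A. u + int z = s + int b"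
    proof (cases "u \<in> S")
      case True
      then show ?thesis using paq by blast
    next
      case False
      then have "\<not> P (insert u S)"
        using S(2)[of "insert u S"] fin by auto
      then show ?thesis
        using S(1) u unfolding P_def by (metis finite_insert insert_iff insert_subset)
    qed
    then obtain s b z where *: "s \<in> S" "b \<in> A" "z \<in> A" "u + int z = s + int b" by blast
    then have "s + (int b - int a) \<in> sumset (Suc n0) X"
      using n0 unfolding X_def by auto
    then have "s + (int b - int a) \<in> sumset n X"
      using sumset_mono[OF X0 n] by blast
    moreover have "u = s + (int b - int a) - (int z - int a)"
      using * by simp
    ultimately show ?thesis using * by blast
  qed
  moreover have "int m dvd int b - int a" if "b \<in> A" for b
    using m(2) XH that unfolding X_def by blast
  ultimately show ?thesis
    using that[of a m "Suc n0"] paq m(1) unfolding X_def by blast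
qed

text \<open>The n-th equation on its own, with u in the role of 2^n * y: once y is fixed, the
  equations have no variable in common.\<close>

definition solvable_in :: "nat set \<Rightarrow> nat \<Rightarrow> nat \<Rightarrow> bool" where
  "solvable_in A n u \<longleftrightarrow>
     (\<exists>x z. (\<forall>j\<in>{1..n}. x j \<in> A) \<and> z \<in> A \<and> (\<Sum>j=1..n. x j) + u = z)"

text \<open>All elements of A are congruent modulo m. If one of them is divisible by m, so is a, and
  subtracting a from every variable keeps the constant term of the equation a multiple of m.\<close>

lemma large_equations_solvable:
  assumes "\<not> density_zero A"
  obtains m where "m > 0" "(\<forall>b\<in>A. \<not> m dvd b) \<or>
    (\<exists>n0. \<forall>n\<ge>n0. \<forall>u. m dvd u \<longrightarrow> solvable_in A n u)"
proof -
  obtain a m n0 where a: "a \<in> A" "m > 0" "\<And>b. b \<in> A \<Longrightarrow> int m dvd int b - int a"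
    and sol: "\<And>n u. n \<ge> n0 \<Longrightarrow> int m dvd u \<Longrightarrow>
       \<exists>s\<in>sumset n ((\<lambda>b. int b - int a) ` A). \<exists>z\<in>A. u = s - (int z - int a)"
    using sumset_minus_stabilizes[OF assms] by blast
  have "solvable_in A n u"
    if b: "b \<in> A" "m dvd b" and n: "n \<ge> n0" and u: "m dvd u" for b n u
  proof -
    have "int m dvd int b" using b(2) by simp
    then have "int m dvd int b - (int b - int a)"
      using a(3)[OF b(1)] by (rule dvd_diff)
    then have ma: "int m dvd int a" by simp
    \<comment> \<open>The number to represent is the sum of the x_j - a minus z - a: n copies of a
      leave on one side, one on the other.\<close>
    then have "int m dvd - int u - (int n - 1) * int a"
      using u by (intro dvd_diff dvd_mult) auto
    from sol[OF n this] obtain s z where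
      s: "s \<in> sumset n ((\<lambda>b. int b - int a) ` A)" and z: "z \<in> A"
      and eq: "- int u - (int n - 1) * int a = s - (int z - int a)" by blast
    from s obtain x where x: "\<forall>j\<in>{1..n}. x j \<in> (\<lambda>b. int b - int a) ` A"
      and sx: "s = (\<Sum>j=1..n. x j)"
      unfolding sumset_iff_sum by blast
    have x': "nat (x j + int a) \<in> A \<and> int (nat (x j + int a)) = x j + int a" if "j \<in> {1..n}" for j
      using x that by fastforce
    define S where "S = (\<Sum>j=1..n. nat (x j + int a))"
    have "int S = s + int n * int a"
      unfolding S_def using x' by (simp add: sx sum.distrib)
    then have "int (S + u) = int z"
      using eq by (simp add: algebra_simps)
    then have "(\<Sum>j=1..n. nat (x j + int a)) + u = z"
      unfolding S_def by (simp only: of_nat_eq_iff)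
    then show ?thesis unfolding solvable_in_def
      using x' z by (intro exI[of _ "\<lambda>j. nat (x j + int a)"] exI[of _ z]) blast
  qed
  then show ?thesis using that[of m] a(2) by blast
qed

section \<open>Choice of the modulus and the class, and solution of the whole system\<close>

section \<open>The partition theorem\<close>

theorem theorem4p3:
  fixes A :: "nat \<Rightarrow> nat set" and r :: nat
  assumes "(\<Union>i\<in>{1..r}. A i) = {1..}"
    and "disjoint_family_on A {1..r}"
  shows "\<exists>i\<in>{1..r}. \<exists>(y::nat) (x :: nat \<Rightarrow> nat \<Rightarrow> nat) (z :: nat \<Rightarrow> nat).
           y \<in> A i \<and>
           (\<forall>n\<ge>1. \<forall>j\<in>{1..n}. x n j \<in> A i) \<and>
           (\<forall>n\<ge>1. z n \<in> A i) \<and>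
           (\<forall>n\<ge>1. (\<Sum>j=1..n. x n j) + 2 ^ n * y = z n)"
proof -
  \<comment> \<open>Minimality of \<open>card (I m0)\<close> means that a class containing a
    multiple of \<open>m0\<close> contains multiples of every \<open>m0 * m\<close> with m >
    0.\<close>
  define I where "I m = {i \<in> {1..r}. \<exists>b\<in>A i. m dvd b}" for m
  obtain m0 where m0: "m0 > 0" "\<And>m. m > 0 \<Longrightarrow> card (I m0) \<le> card (I m)"
    using ex_has_least_nat[of "\<lambda>m. m > 0" 1 "\<lambda>m. card (I m)"] by auto
  define B where "B i = A i \<inter> {b. m0 dvd b}" for i
  define G where "G = {i \<in> {1..r}. \<not> density_zero (B i)}"
  have "\<exists>m. m > 0 \<and> (\<exists>n0. \<forall>n\<ge>n0. \<forall>u. m dvd u \<longrightarrow> solvable_in (B i) n u)"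
    if i: "i \<in> G" for i
  proof -
    have nz: "\<not> density_zero (B i)" using i by (simp add: G_def)
    obtain m where m: "m > 0" and cases: "(\<forall>b\<in>B i. \<not> m dvd b) \<or>
      (\<exists>n0. \<forall>n\<ge>n0. \<forall>u. m dvd u \<longrightarrow> solvable_in (B i) n u)"
      using large_equations_solvable[OF nz] by blast
    \<comment> \<open>Not being of density zero, \<open>B i\<close> is nonempty, so i counts for
      \<open>m0\<close>; without a multiple of m in \<open>B i\<close> it would not count for
      \<open>m0 * m\<close>.\<close>
    have hit: "\<not> (\<forall>b\<in>B i. \<not> m dvd b)"
    proof
      assume none: "\<forall>b\<in>B i. \<not> m dvd b"
      have "B i \<noteq> {}" using nz density_zero_finite by auto
      then have "i \<in> I m0" using i unfolding I_def G_def B_def by auto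
      moreover have "i \<notin> I (m0 * m)"
        using none unfolding I_def B_def by (auto dest: dvd_mult_left dvd_mult_right)
      moreover have "I (m0 * m) \<subseteq> I m0"
        unfolding I_def by (auto dest: dvd_mult_left)
      ultimately have "I (m0 * m) \<subset> I m0" by blast
      moreover have "finite (I m0)" by (simp add: I_def)
      ultimately have "card (I (m0 * m)) < card (I m0)" by (rule psubset_card_mono[rotated])
      then show False using m0(2)[of "m0 * m"] m m0(1) by simp
    qed
    show ?thesis
      by (rule exI[of _ m], rule conjI[OF m mp[OF cases[unfolded disj_imp] hit]])
  qed
  then obtain m n0 where m: "\<And>i. i \<in> G \<Longrightarrow> m i > 0"
    and large: "\<And>i n u. i \<in> G \<Longrightarrow> n \<ge> n0 i \<Longrightarrow> m i dvd u \<Longrightarrow>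
       solvable_in (B i) n u"
    by metis
  have finG: "finite G" by (simp add: G_def)
  \<comment> \<open>Multiples of D lie in the sets \<open>B i\<close> and are admissible as y in the
    large equations of every class in G.\<close>
  define D where "D = m0 * (\<Prod>i\<in>G. m i)"
  have D: "D > 0" unfolding D_def using m0(1) m by (simp add: prod_pos)
  have mD: "m i dvd D" if "i \<in> G" for i
    unfolding D_def using that finG by (simp add: dvd_prodI dvd_mult)
  define n1 where "n1 = (\<Sum>i\<in>G. n0 i)"
  have n1: "n0 i \<le> n1" if "i \<in> G" for i
    unfolding n1_def using that finG by (intro member_le_sum) auto
  \<comment> \<open>L bounds n - 1 + 2^n for all n < \<open>n1\<close>, the coefficients of y in the
    small equations.\<close>
  define L where "L = 2 ^ n1 + n1"
  obtain M where M: "\<And>col :: nat \<Rightarrow> nat. col ` {1..M} \<subseteq> G \<Longrightarrow>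
      \<exists>a y. a > 0 \<and> y > 0 \<and> y \<le> M \<and> a + L * y \<le> M \<and> (\<forall>j\<le>L. col (a + j * y) = col y)"
    using Brauer[OF finG, of L] by metis
  have "density_zero (\<Union>i\<in>{1..r} - G. B i)"
    by (intro density_zero_UN) (auto simp: G_def)
  moreover have "finite ((*) D ` {1..M})" by simp
  moreover have "x > 0" if "x \<in> (*) D ` {1..M}" for x using that D by auto
  \<comment> \<open>M is already fixed, so only the finite pattern D * {1..M} has to be moved off
    the classes of density zero.\<close>
  ultimately obtain t where t: "t > 0"
    and tB: "\<And>x. x \<in> (*) D ` {1..M} \<Longrightarrow> t * x \<notin> (\<Union>i\<in>{1..r} - G. B i)"
    using density_zero_avoid_dilate by metis
  define e where "e = t * D"
  have "\<exists>i\<in>G. e * j \<in> B i" if "j \<in> {1..M}" for j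
  proof -
    have "e * j \<in> (\<Union>i\<in>{1..r}. A i)" using assms(1) t D that by (auto simp: e_def)
    then obtain i where "i \<in> {1..r}" "e * j \<in> A i" by blast
    moreover have "m0 dvd e * j" by (simp add: e_def D_def)
    moreover have "e * j \<notin> (\<Union>i\<in>{1..r} - G. B i)"
      using tB[OF imageI[OF that]] by (simp add: e_def mult.assoc)
    ultimately show ?thesis unfolding B_def by blast
  qed
  then obtain col where col: "\<And>j. j \<in> {1..M} \<Longrightarrow> col j \<in> G \<and> e * j \<in> B (col j)"
    by metis
  then have "col ` {1..M} \<subseteq> G" by blast
  from M[OF this] obtain a y where ay: "a > 0" "y > 0" "y \<le> M" "a + L * y \<le> M"
    "\<And>j. j \<le> L \<Longrightarrow> col (a + j * y) = col y" by blast
  define i where "i = col y"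
  have iG: "i \<in> G" and yB: "e * y \<in> B i"
    using col[of y] ay by (auto simp: i_def)
  have aB: "e * (a + j * y) \<in> B i" if "j \<le> L" for j
  proof -
    have "j * y \<le> L * y" using that by simp
    then have "a + j * y \<le> M" using ay(4) by linarith
    then have "a + j * y \<in> {1..M}" using ay(1) by simp
    then show ?thesis using col ay(5)[OF that] unfolding i_def by metis
  qed
  have solv: "solvable_in (B i) n (2 ^ n * (e * y))"
    if n: "n \<ge> 1" for n
  proof (cases "n \<ge> n1")
    case True
    have "m i dvd 2 ^ n * (e * y)"
      unfolding e_def using mD[OF iG] by (simp add: dvd_mult dvd_mult2)
    then show ?thesis
      using large[OF iG] n1[OF iG] True order.trans by blast
  next
    case False
    \<comment> \<open>The first variable is e * a, all others equal e * y; the value of the left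
      side is then the term with index n - 1 + 2^n of Brauer's progression, scaled by e.\<close>
    define x where "x = (\<lambda>_::nat. e * y)(1 := e * a)"
    have "(\<Sum>j=1..n. x j) = e * a + (n - 1) * (e * y)"
    proof -
      have "{1..n} = insert 1 {2..n}" using n by auto
      then have "(\<Sum>j=1..n. x j) = e * a + (\<Sum>j=2..n. x j)" by (simp add: x_def)
      also have "(\<Sum>j=2..n. x j) = (\<Sum>j=2..n. e * y)"
        by (intro sum.cong) (auto simp: x_def)
      finally show ?thesis by simp
    qed
    then have "(\<Sum>j=1..n. x j) + 2 ^ n * (e * y) = e * (a + (n - 1 + 2 ^ n) * y)"
      by (simp add: algebra_simps)
    moreover have "(2::nat) ^ n \<le> 2 ^ n1" using False by (intro power_increasing) auto
    then have "n - 1 + 2 ^ n \<le> L" using False unfolding L_def by linarith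
    ultimately have "(\<Sum>j=1..n. x j) + 2 ^ n * (e * y) \<in> B i"
      using aB by metis
    moreover have "x j \<in> B i" for j
      using aB[of 0] yB by (simp add: x_def)
    ultimately show ?thesis unfolding solvable_in_def by (intro exI[of _ x]) simp
  qed
  \<comment> \<open>The class and e * y do not depend on n, so the other variables may be chosen
    separately for each n.\<close>
  have "\<forall>n\<in>{1..}. \<exists>x z.
      (\<forall>j\<in>{1..n}. x j \<in> B i) \<and> z \<in> B i \<and> (\<Sum>j=1..n. x j) + 2 ^ n * (e * y) = z"
    using solv unfolding solvable_in_def by simp
  from bchoice[OF this] obtain x where "\<forall>n\<in>{1..}. \<exists>z.
      (\<forall>j\<in>{1..n}. x n j \<in> B i) \<and> z \<in> B i \<and> (\<Sum>j=1..n. x n j) + 2 ^ n * (e * y) = z"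
    by (rule exE)
  from bchoice[OF this] obtain z where xz: "\<forall>n\<in>{1..}.
      (\<forall>j\<in>{1..n}. x n j \<in> B i) \<and> z n \<in> B i \<and> (\<Sum>j=1..n. x n j) + 2 ^ n * (e * y) = z n"
    by (rule exE)
  show ?thesis
  proof (rule bexI, rule exI, rule exI, rule exI, intro conjI allI impI)
    show "i \<in> {1..r}" using iG by (simp add: G_def)
    show "e * y \<in> A i" using yB by (simp add: B_def)
    fix n :: nat assume "n \<ge> 1"
    then have n: "n \<in> {1..}" by simp
    show "\<forall>j\<in>{1..n}. x n j \<in> A i" "z n \<in> A i"
      "(\<Sum>j=1..n. x n j) + 2 ^ n * (e * y) = z n"
      using bspec[OF xz n] by (auto simp: B_def)
  qed
qed

end
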